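(* (Well-balance of the positivity-preserving limiter with bottom correction.) Let $C_1,C_2>0$ and let $h_h^{mod},\eta_h^{mod},b_h\in\mathcal V_h^k$ satisfy $\eta_h^{mod}=C_1h_h^{mod}$ and $h_h^{mod}+b_h=C_2$. On each element $K\in\mathcal T_h$, with cell averages denoted by bars, define $$\hat h_h^{mod}(\bm x)=\lambda_h\big(h_h^{mod}(\bm x)-\bar h_h^{mod}\big)+\bar h_h^{mod},\qquad\lambda_h=\min\Big\{1,\frac{\bar h_h^{mod}}{\bar h_h^{mod}-\min_{\hat{\bm x}_\alpha\in G_p}h_h^{mod}(\hat{\bm x}_\alpha)}\Big\},$$ $$\hat\eta_h^{mod}(\bm x)=\lambda_\eta\big(\eta_h^{mod}(\bm x)-\bar\eta_h^{mod}\big)+\bar\eta_h^{mod},\qquad\lambda_\eta=\min\Big\{1,\frac{\bar\eta_h^{mod}}{\bar\eta_h^{mod}-\min_{\hat{\bm x}_\alpha\in G_p}\eta_h^{mod}(\hat{\bm x}_\alpha)}\Big\},$$ and set $$\hat b_h=b_h-(\hat h_h^{mod}-h_h^{mod}).$$ Then $$\hat\eta_h^{mod}=C_1\hat h_h^{mod}\qquad\text{and}\qquad\hat h_h^{mod}+\hat b_h=C_2 .$$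
   Context: $\mathcal T_h$ is a triangular mesh of a domain $\Omega$, $k\ge1$ an integer, and $\mathcal V_h^k=\{q\in L^2(\Omega):q|_K\in\mathbb P^k(K)\ \forall K\in\mathcal T_h\}$, where $\mathbb P^k(K)$ is the set of polynomials of degree at most $k$ on $K$. For each element $K$, $G_p=G_p(K)\subset K$ is a fixed finite nonempty set of quadrature points (the same set for $h$ and $\eta$). If a denominator in the definition of $\lambda_h$ or $\lambda_\eta$ vanishes, the corresponding $\lambda$ is taken to be $1$. Here $h$ is the water depth, $\eta$ the depth times temperature and $b$ the bottom topography of the Ripa model, and $\eta=C_1h$, $h+b=C_2$ are the depth/temperature relations of its lake-at-rest steady state (the momenta are not modified by this limiter). *)

theory Defs
  imports "HOL-Analysis.Analysis"
begin

text \<open>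
  Elements of \<open>L\<^sup>2\<close> are represented by functions on the plane, equality in \<open>L\<^sup>2(\<Omega>)\<close> being
  equality almost everywhere on \<open>\<Omega>\<close>. Since a piecewise polynomial is in general two-valued on
  the edges of the mesh, the restriction of such a class to a closed element \<open>K\<close> is the
  polynomial on \<open>K\<close> that represents it there, so point values on the boundary of \<open>K\<close> are
  traces taken from inside \<open>K\<close>.
\<close>

text \<open>Elements are closed nondegenerate triangles; hanging nodes are not excluded. The inclusion
  \<open>interior K \<subseteq> \<Omega>\<close> does not follow from the covering condition, as \<open>\<Omega>\<close> may be smaller than the
  interior of its closure.\<close>

definition triangular_mesh :: "(real^2) set \<Rightarrow> (real^2) set set \<Rightarrow> bool" where
  "triangular_mesh \<Omega> \<T> \<longleftrightarrow>
     finite \<T> \<and>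
     (\<forall>K\<in>\<T>. 2 simplex K \<and> interior K \<subseteq> \<Omega>) \<and>
     (\<forall>K\<in>\<T>. \<forall>K'\<in>\<T>. K \<noteq> K' \<longrightarrow> interior K \<inter> interior K' = {}) \<and>
     \<Union>\<T> = closure \<Omega>"

definition poly_on :: "nat \<Rightarrow> (real^2) set \<Rightarrow> (real^2 \<Rightarrow> real) set" where
  "poly_on k K =
     {restrict (\<lambda>x. \<Sum>i\<le>k. \<Sum>j\<le>k - i. c i j * (x$1)^i * (x$2)^j) K | c :: nat \<Rightarrow> nat \<Rightarrow> real. True}"

definition L2_on :: "(real^2) set \<Rightarrow> (real^2 \<Rightarrow> real) set" where
  "L2_on \<Omega> = {q. q \<in> borel_measurable (lebesgue_on \<Omega>) \<and> integrable (lebesgue_on \<Omega>) (\<lambda>x. (q x)\<^sup>2)}"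

definition dg_space :: "(real^2) set \<Rightarrow> (real^2) set set \<Rightarrow> nat \<Rightarrow> (real^2 \<Rightarrow> real) set" where
  "dg_space \<Omega> \<T> k =
     {q \<in> L2_on \<Omega>. \<forall>K\<in>\<T>. \<exists>r\<in>poly_on k K. AE x in lebesgue_on K. q x = r x}"

definition elem_restrict :: "nat \<Rightarrow> (real^2) set \<Rightarrow> (real^2 \<Rightarrow> real) \<Rightarrow> real^2 \<Rightarrow> real" where
  "elem_restrict k K q = (THE r. r \<in> poly_on k K \<and> (AE x in lebesgue_on K. q x = r x))"

definition cell_avg :: "(real^2) set \<Rightarrow> (real^2 \<Rightarrow> real) \<Rightarrow> real" where
  "cell_avg K q = (LINT x|lebesgue_on K. q x) / measure lebesgue K"

definition limiter_coeff :: "nat \<Rightarrow> (real^2) set \<Rightarrow> (real^2) set \<Rightarrow> (real^2 \<Rightarrow> real) \<Rightarrow> real" where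
  "limiter_coeff k K P q =
     (let d = cell_avg K q - Min (elem_restrict k K q ` P)
      in if d = 0 then 1 else min 1 (cell_avg K q / d))"

text \<open>The sum assembles the elementwise definition: the interiors of the elements are disjoint,
  so at most one term is nonzero, and the edges form a null set.\<close>

definition pp_limiter ::
  "(real^2) set set \<Rightarrow> nat \<Rightarrow> ((real^2) set \<Rightarrow> (real^2) set) \<Rightarrow> (real^2 \<Rightarrow> real) \<Rightarrow> real^2 \<Rightarrow> real" where
  "pp_limiter \<T> k G q x =
     (\<Sum>K\<in>\<T>. indicat_real (interior K) x *
        (limiter_coeff k K (G K) q * (q x - cell_avg K q) + cell_avg K q))"

definition bottom_correction ::
  "(real^2) set set \<Rightarrow> nat \<Rightarrow> ((real^2) set \<Rightarrow> (real^2) set) \<Rightarrow> (real^2 \<Rightarrow> real) \<Rightarrow> (real^2 \<Rightarrow> real)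
     \<Rightarrow> real^2 \<Rightarrow> real" where
  "bottom_correction \<T> k G h b x = b x - (pp_limiter \<T> k G h x - h x)"

end

theory Submission
  imports Defs
begin

text \<open>
  The limiter is positively homogeneous. On an element \<open>K\<close>, multiplying a function by \<open>C > 0\<close>
  multiplies its cell average by \<open>C\<close> and, as \<open>C\<close> is positive, also its minimum over the
  quadrature points; the quotient defining the coefficient \<open>\<lambda>\<close>, and the degenerate case of a
  vanishing denominator, are therefore unchanged (\<open>limiter_coeff_scale\<close>). With equal
  coefficients the limited function \<open>\<lambda> (q - avg) + avg\<close> is linear in \<open>q\<close>, which gives the
  first claim. The second claim is the cancellation built into the corrected bottom.

  The point that needs care is that \<open>\<eta> = C h\<close> holds only almost everywhere, whereas the limiter
  evaluates traces at finitely many points. These values belong to the polynomial representing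
  the function on \<open>K\<close>, and that polynomial is determined by the almost everywhere class
  (\<open>poly_on_AE_unique\<close>): two continuous functions that agree almost everywhere on a triangle agree
  on its interior, hence on the triangle, which is the closure of its interior. So the
  representative of \<open>\<eta>\<close> is \<open>C\<close> times that of \<open>h\<close> at every point of \<open>K\<close>.
\<close>

text \<open>
  A 2-simplex has full affine dimension in the plane, so its relative interior, which is nonempty
  by convexity, is its interior.
\<close>

lemma closure_interior_triangle:
  fixes K :: "(real^2) set"
  assumes "2 simplex K"
  shows "closure (interior K) = K"
proof -
  have cK: "convex K" and clK: "closed K"
    using assms convex_simplex closed_simplex by auto
  have "aff_dim K = 2" using aff_dim_simplex[OF assms] by simp
  then have full: "affine hull K = UNIV" and ne: "K \<noteq> {}"
    by (auto simp: aff_dim_eq_full[symmetric])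
  have "interior K \<noteq> {}"
    using rel_interior_eq_empty[OF cK] ne rel_interior_interior[OF full] by simp
  then show ?thesis using convex_closure_interior[OF cK] clK by simp
qed

text \<open>
  The steady-state relation is given on \<open>\<Omega>\<close>, which need not contain the edges of the elements.
  Nothing is lost in passing to the closed element, because the boundary of a convex set is
  negligible.
\<close>

lemma AE_lebesgue_on_interior_convex:
  fixes K :: "'a::euclidean_space set"
  assumes "convex K" "closed K" "interior K \<subseteq> S" "S \<in> sets lebesgue"
    and "AE x in lebesgue_on S. P x"
  shows "AE x in lebesgue_on K. P x"
proof -
  have "frontier K \<in> null_sets lebesgue"
    using negligible_convex_frontier[OF assms(1)] negligible_iff_null_sets by blast
  then have "AE x in lebesgue. x \<notin> frontier K" by (rule AE_not_in)
  moreover have "AE x in lebesgue. x \<in> S \<longrightarrow> P x"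
    using assms(4,5) by (simp add: AE_restrict_space_iff)
  ultimately have "AE x in lebesgue. x \<in> K \<longrightarrow> P x"
    by eventually_elim (use assms(2,3) in \<open>auto simp: frontier_def\<close>)
  then show ?thesis using assms(2) by (simp add: AE_restrict_space_iff)
qed

text \<open>
  The points of the interior where \<open>f\<close> and \<open>g\<close> differ form an open null set, which must be empty;
  the set where they agree is closed, so it contains the closure of the interior as well.
\<close>

lemma continuous_AE_eq_imp_eq_closure_interior:
  fixes f g :: "'a::euclidean_space \<Rightarrow> real"
  assumes f: "continuous_on UNIV f" and g: "continuous_on UNIV g"
    and K: "K \<in> sets lebesgue" and ae: "AE x in lebesgue_on K. f x = g x"
    and x: "x \<in> closure (interior K)"
  shows "f x = g x"
proof -
  let ?D = "interior K \<inter> {x. f x \<noteq> g x}"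
  have "open ?D" using f g by (intro open_Int open_Collect_neq) auto
  moreover have "AE x in lebesgue. x \<notin> ?D"
    using ae K interior_subset[of K] by (auto simp: AE_restrict_space_iff elim!: eventually_mono)
  then have "negligible ?D"
    using \<open>open ?D\<close> by (simp add: negligible_iff_null_sets AE_iff_null_sets borel_open)
  ultimately have "?D = {}" using open_not_negligible by blast
  then have "f y = g y" if "y \<in> interior K" for y using that by blast
  moreover have "closed {x. f x = g x}" using f g by (rule closed_Collect_eq)
  ultimately have "closure (interior K) \<subseteq> {x. f x = g x}"
    by (intro closure_minimal) auto
  with x show ?thesis by blast
qed

lemma poly_on_scale:
  assumes "r \<in> poly_on k K"
  shows "restrict (\<lambda>x. C * r x) K \<in> poly_on k K"
proof -
  obtain c where c: "r = restrict (\<lambda>x. \<Sum>i\<le>k. \<Sum>j\<le>k - i. c i j * (x$1)^i * (x$2)^j) K"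
    using assms by (auto simp: poly_on_def)
  have "restrict (\<lambda>x. C * r x) K =
      restrict (\<lambda>x. \<Sum>i\<le>k. \<Sum>j\<le>k - i. (C * c i j) * (x$1)^i * (x$2)^j) K"
    unfolding c by (rule restrict_ext) (simp add: sum_distrib_left mult.assoc)
  then show ?thesis
    unfolding poly_on_def mem_Collect_eq by (intro exI[of _ "\<lambda>i j. C * c i j"]) simp
qed

lemma poly_on_AE_unique:
  assumes K: "2 simplex K" and r: "r \<in> poly_on k K" and s: "s \<in> poly_on k K"
    and ae: "AE x in lebesgue_on K. r x = s x"
  shows "r = s"
proof -
  obtain c where c: "r = restrict (\<lambda>x. \<Sum>i\<le>k. \<Sum>j\<le>k - i. c i j * (x$1)^i * (x$2)^j) K"
    using r by (auto simp: poly_on_def)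
  obtain d where d: "s = restrict (\<lambda>x. \<Sum>i\<le>k. \<Sum>j\<le>k - i. d i j * (x$1)^i * (x$2)^j) K"
    using s by (auto simp: poly_on_def)
  let ?p = "\<lambda>c (x::real^2). \<Sum>i\<le>k. \<Sum>j\<le>k - i. c i j * (x$1)^i * (x$2)^j"
  have lK: "K \<in> sets lebesgue" using closed_simplex[OF K] by simp
  have "AE x in lebesgue_on K. ?p c x = ?p d x"
    using AE_space ae by eventually_elim (simp add: c d)
  then have "?p c x = ?p d x" if "x \<in> K" for x
    using that closure_interior_triangle[OF K]
    by (intro continuous_AE_eq_imp_eq_closure_interior[OF _ _ lK]) (auto intro!: continuous_intros)
  then show ?thesis unfolding c d by (intro restrict_ext) blast
qed

text \<open>
  Uniqueness turns the definite description into a computation rule: any polynomial in the class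
  of \<open>q\<close> is the restriction of \<open>q\<close>.
\<close>

lemma elem_restrict_eqI:
  assumes "2 simplex K" "r \<in> poly_on k K" "AE x in lebesgue_on K. q x = r x"
  shows "elem_restrict k K q = r"
  unfolding elem_restrict_def
proof (rule the_equality)
  show "r \<in> poly_on k K \<and> (AE x in lebesgue_on K. q x = r x)" using assms by blast
next
  fix s assume s: "s \<in> poly_on k K \<and> (AE x in lebesgue_on K. q x = s x)"
  with assms(3) have "AE x in lebesgue_on K. s x = r x" by (auto elim: eventually_elim2)
  with s show "s = r" using poly_on_AE_unique[OF assms(1)] assms(2) by blast
qed

lemma poly_on_measurable:
  assumes "r \<in> poly_on k K" "K \<in> sets lebesgue"
  shows "r \<in> borel_measurable (lebesgue_on K)"
proof -
  obtain c where c: "r = restrict (\<lambda>x. \<Sum>i\<le>k. \<Sum>j\<le>k - i. c i j * (x$1)^i * (x$2)^j) K"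
    using assms(1) by (auto simp: poly_on_def)
  have "continuous_on K (\<lambda>x. \<Sum>i\<le>k. \<Sum>j\<le>k - i. c i j * (x$1)^i * (x$2)^j)"
    by (intro continuous_intros)
  then have "continuous_on K r" by (simp add: c cong: continuous_on_cong)
  then show ?thesis using assms(2) by (rule continuous_imp_measurable_on_sets_lebesgue)
qed

text \<open>
  This supplies the measurability needed to compare integrals of functions agreeing almost
  everywhere: members of the discrete space inherit it on \<open>K\<close> from their polynomials, even though
  \<open>K\<close> need not be contained in \<open>\<Omega>\<close>. It rests on the completeness of Lebesgue measure.
\<close>

lemma borel_measurable_lebesgue_on_AE:
  fixes f g :: "'a::euclidean_space \<Rightarrow> 'b::euclidean_space"
  assumes "f \<in> borel_measurable (lebesgue_on S)" "S \<in> sets lebesgue"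
    and "AE x in lebesgue_on S. f x = g x"
  shows "g \<in> borel_measurable (lebesgue_on S)"
proof -
  have "(\<lambda>x. indicat_real S x *\<^sub>R f x) \<in> borel_measurable lebesgue"
    using assms(1,2) by (simp add: borel_measurable_restrict_space_iff)
  moreover have "AE x in lebesgue. x \<in> S \<longrightarrow> f x = g x"
    using assms(2,3) by (simp add: AE_restrict_space_iff)
  then have "AE x in lebesgue. indicat_real S x *\<^sub>R f x = indicat_real S x *\<^sub>R g x"
    by eventually_elim (auto simp: indicator_def)
  ultimately have "(\<lambda>x. indicat_real S x *\<^sub>R g x) \<in> borel_measurable lebesgue"
    by (rule borel_measurable_AE)
  then show ?thesis using assms(2) by (simp add: borel_measurable_restrict_space_iff)
qed

lemma cell_avg_scale:
  assumes "f \<in> borel_measurable (lebesgue_on K)" "g \<in> borel_measurable (lebesgue_on K)"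
    and "AE x in lebesgue_on K. g x = C * f x"
  shows "cell_avg K g = C * cell_avg K f"
proof -
  have "(LINT x|lebesgue_on K. g x) = (LINT x|lebesgue_on K. C * f x)"
    using assms by (intro integral_cong_AE) auto
  then show ?thesis by (simp add: cell_avg_def)
qed

text \<open>
  Positivity of \<open>C\<close> is what lets the minimum commute with the scaling. Average and denominator
  then acquire the same nonzero factor, so the case distinction and the quotient are both
  unaffected.
\<close>

lemma limiter_coeff_scale:
  assumes C: "C > 0" and P: "finite P" "P \<noteq> {}"
    and avg: "cell_avg K g = C * cell_avg K f"
    and pts: "\<And>x. x \<in> P \<Longrightarrow> elem_restrict k K g x = C * elem_restrict k K f x"
  shows "limiter_coeff k K P g = limiter_coeff k K P f"
proof -
  have "mono ((*) C)" using C by (simp add: mono_def)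
  then have "C * Min (elem_restrict k K f ` P) = Min ((*) C ` elem_restrict k K f ` P)"
    using P by (intro mono_Min_commute) auto
  also have "(*) C ` elem_restrict k K f ` P = elem_restrict k K g ` P"
    using pts by (simp add: image_image cong: image_cong)
  finally have "cell_avg K g - Min (elem_restrict k K g ` P)
      = C * (cell_avg K f - Min (elem_restrict k K f ` P))"
    by (simp add: avg algebra_simps)
  then show ?thesis using C by (simp add: limiter_coeff_def Let_def avg)
qed

theorem mainTheorem5:
  fixes \<Omega> :: "(real^2) set" and \<T> :: "(real^2) set set" and k :: nat
    and G :: "(real^2) set \<Rightarrow> (real^2) set"
    and C1 C2 :: real and h \<eta> b :: "real^2 \<Rightarrow> real"
  assumes "open \<Omega>" and "connected \<Omega>" and "\<Omega> \<noteq> {}"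
    and "triangular_mesh \<Omega> \<T>"
    and "k \<ge> 1"
    and "\<And>K. K \<in> \<T> \<Longrightarrow> finite (G K) \<and> G K \<noteq> {} \<and> G K \<subseteq> K"
    and "C1 > 0" and "C2 > 0"
    and "h \<in> dg_space \<Omega> \<T> k" and "\<eta> \<in> dg_space \<Omega> \<T> k" and "b \<in> dg_space \<Omega> \<T> k"
    and "AE x in lebesgue_on \<Omega>. \<eta> x = C1 * h x"
    and "AE x in lebesgue_on \<Omega>. h x + b x = C2"
  shows "(AE x in lebesgue_on \<Omega>. pp_limiter \<T> k G \<eta> x = C1 * pp_limiter \<T> k G h x) \<and>
         (AE x in lebesgue_on \<Omega>. pp_limiter \<T> k G h x + bottom_correction \<T> k G h b x = C2)"
proof
  have elem: "cell_avg K \<eta> = C1 * cell_avg K h \<and>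
      limiter_coeff k K (G K) \<eta> = limiter_coeff k K (G K) h" if KT: "K \<in> \<T>" for K
  proof -
    have K: "2 simplex K" and sub: "interior K \<subseteq> \<Omega>"
      using assms(4) KT by (auto simp: triangular_mesh_def)
    have lK: "K \<in> sets lebesgue" using closed_simplex[OF K] by simp
    have ae: "AE x in lebesgue_on K. \<eta> x = C1 * h x"
      using convex_simplex[OF K] closed_simplex[OF K] sub _ assms(12)
      by (rule AE_lebesgue_on_interior_convex) (simp add: assms(1) borel_open)
    obtain r where r: "r \<in> poly_on k K" and hr: "AE x in lebesgue_on K. h x = r x"
      using assms(9) KT by (auto simp: dg_space_def)
    let ?s = "restrict (\<lambda>x. C1 * r x) K"
    have s: "?s \<in> poly_on k K" using r by (rule poly_on_scale)
    have \<eta>s: "AE x in lebesgue_on K. \<eta> x = ?s x"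
      using AE_space ae hr by eventually_elim simp
    have "h \<in> borel_measurable (lebesgue_on K)"
      using hr by (intro borel_measurable_lebesgue_on_AE[OF poly_on_measurable[OF r lK] lK]) (simp add: eq_commute)
    moreover have "\<eta> \<in> borel_measurable (lebesgue_on K)"
      using \<eta>s by (intro borel_measurable_lebesgue_on_AE[OF poly_on_measurable[OF s lK] lK]) (simp add: eq_commute)
    ultimately have avg: "cell_avg K \<eta> = C1 * cell_avg K h"
      using ae by (rule cell_avg_scale)
    moreover have "limiter_coeff k K (G K) \<eta> = limiter_coeff k K (G K) h"
      using assms(6)[OF KT] elem_restrict_eqI[OF K r hr] elem_restrict_eqI[OF K s \<eta>s]
      by (intro limiter_coeff_scale[OF assms(7) _ _ avg]) auto
    ultimately show ?thesis by blast
  qed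
  \<comment> \<open>The identity is inherited pointwise, so no second exceptional set arises.\<close>
  have "pp_limiter \<T> k G \<eta> x = C1 * pp_limiter \<T> k G h x" if "\<eta> x = C1 * h x" for x
    unfolding pp_limiter_def sum_distrib_left
    by (rule sum.cong) (use that elem in \<open>simp_all add: algebra_simps\<close>)
  then show "AE x in lebesgue_on \<Omega>. pp_limiter \<T> k G \<eta> x = C1 * pp_limiter \<T> k G h x"
    using assms(12) by (auto elim: eventually_mono)
next
  show "AE x in lebesgue_on \<Omega>. pp_limiter \<T> k G h x + bottom_correction \<T> k G h b x = C2"
    using assms(13) by (auto simp: bottom_correction_def algebra_simps elim!: eventually_mono)
qed

end
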